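(* Let $(X,\ll,\tau)$ be a chronologically dense regular chronological space. Then for all $x,y\in X$, $x\,\alpha(\ll)\,y\Rightarrow i_X(x)\,\alpha(\ll_{BS})\,i_X(y)$. Moreover, if $(X,\ll,\tau)$ is $\alpha$-causally simple, then 1. $x\,\alpha(\ll)\,y\Leftrightarrow i_X(x)\,\alpha(\ll_{BS})\,i_X(y)$ for all $x,y\in X$; 2. $J^\pm(C)=\mathrm{cl}(I^\pm(C))$ for all compact subsets $C$ of $X$; in particular $J^\pm(p)=\mathrm{cl}(I^\pm(p))$ for all $p\in X$; 3. $(X,\ll,\tau)$ is causally continuous.
   Context: A chronological (chr.) set $(X,\ll)$ is a set $X$ with a transitive, irreflexive relation $\ll$ for which there is a countable $S\subset X$ such that $x\ll y$ implies $x\ll s\ll y$ for some $s\in S$. Put $I^-(x)=\{y: y\ll x\}$, $I^+(x)=\{y:x\ll y\}$, $I^\pm(A)=\bigcup_{x\in A}I^\pm(x)$. $A\subset X$ is past iff $I^-(A)=A$. A nonempty past set $U$ is indecomposable iff $U=A\cup B$ with $A,B$ past implies $U=A$ or $U=B$; $IP(X)$ is the set of these; indecomposable future sets are defined dually. $X$ is preregular iff for all $p$, $I^-(p)$ is an indecomposable past set and $I^+(p)$ an indecomposable future set; $I^-$-distinguishing iff $x\mapsto I^-(x)$ is injective; past-reflecting iff $I^-(x)\subset I^-(y)\Rightarrow I^+(y)\subset I^+(x)$. A chr. space is $(X,\tau,\ll)$ with $\tau$ a topology and $(X,\ll)$ an $I^-$-distinguishing, preregular, past-reflecting chr. set; it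 is regular iff moreover all $I^\pm(p)$ are open. It is chronologically dense iff $p\in\mathrm{cl}(I^\pm(p))$ for all $p$ with $I^\pm(p)\neq\emptyset$. For a chr. relation $\ll$ on a set, $x\,\alpha(\ll)\,y$ iff $I^+(y)\subset I^+(x)$ and $I^-(x)\subset I^-(y)$. With $\leq=\alpha(\ll)$ put $J^+(x)=\{y:x\le y\}$, $J^-(x)=\{y:y\le x\}$, $J^\pm(A)=\bigcup_{x\in A}J^\pm(x)$. $X$ is $\alpha$-causally simple iff $J^+(p)$ and $J^-(p)$ are closed for every $p\in X$. On $IP(X)$, $A\ll_{BS}B$ iff there is $x\in B$ with $A\subset I^-(x)$, and $i_X:X\to IP(X)$, $i_X(x)=I^-(x)$. $X$ is causally continuous iff $I^+$ and $I^-$, as maps from $X$ to the open subsets of $X$, are inner and outer continuous at every point, where $F$ is inner (outer) continuous at $p$ iff for each compact $C\subset F(p)$ (resp. $C\subset X\setminus\mathrm{cl}(F(p))$) there is a neighborhood $U$ of $p$ with $C\subset F(q)$ (resp. $C\subset X\setminus\mathrm{cl}(F(q))$) for all $q\in U$. *)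

theory Defs
  imports "HOL-Analysis.Analysis"
begin

text \<open>
  A relation on a set \<open>X\<close> is a set of pairs contained in \<open>X \<times> X\<close>. The carrier is a set rather
  than a whole type because the relation \<open>\<alpha>\<close> below is also formed on the set of indecomposable
  past sets. For a topological carrier \<open>T :: 'a topology\<close> the underlying set is \<open>topspace T\<close>.
\<close>

definition I_past :: "'a rel \<Rightarrow> 'a \<Rightarrow> 'a set" where
  "I_past R x = {y. (y, x) \<in> R}"

definition I_future :: "'a rel \<Rightarrow> 'a \<Rightarrow> 'a set" where
  "I_future R x = {y. (x, y) \<in> R}"

definition I_past_of :: "'a rel \<Rightarrow> 'a set \<Rightarrow> 'a set" where
  "I_past_of R A = (\<Union>x\<in>A. I_past R x)"

definition I_future_of :: "'a rel \<Rightarrow> 'a set \<Rightarrow> 'a set" where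
  "I_future_of R A = (\<Union>x\<in>A. I_future R x)"

definition chronological_set :: "'a set \<Rightarrow> 'a rel \<Rightarrow> bool" where
  "chronological_set X R \<longleftrightarrow>
     R \<subseteq> X \<times> X \<and> trans R \<and> irrefl R \<and>
     (\<exists>S \<subseteq> X. countable S \<and>
        (\<forall>x y. (x, y) \<in> R \<longrightarrow> (\<exists>s\<in>S. (x, s) \<in> R \<and> (s, y) \<in> R)))"

definition past_set :: "'a set \<Rightarrow> 'a rel \<Rightarrow> 'a set \<Rightarrow> bool" where
  "past_set X R A \<longleftrightarrow> A \<subseteq> X \<and> I_past_of R A = A"

definition future_set :: "'a set \<Rightarrow> 'a rel \<Rightarrow> 'a set \<Rightarrow> bool" where
  "future_set X R A \<longleftrightarrow> A \<subseteq> X \<and> I_future_of R A = A"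

definition IP :: "'a set \<Rightarrow> 'a rel \<Rightarrow> 'a set set" where
  "IP X R = {U. U \<noteq> {} \<and> past_set X R U \<and>
     (\<forall>A B. past_set X R A \<and> past_set X R B \<and> U = A \<union> B \<longrightarrow> U = A \<or> U = B)}"

definition IF :: "'a set \<Rightarrow> 'a rel \<Rightarrow> 'a set set" where
  "IF X R = {U. U \<noteq> {} \<and> future_set X R U \<and>
     (\<forall>A B. future_set X R A \<and> future_set X R B \<and> U = A \<union> B \<longrightarrow> U = A \<or> U = B)}"

definition preregular :: "'a set \<Rightarrow> 'a rel \<Rightarrow> bool" where
  "preregular X R \<longleftrightarrow> (\<forall>p\<in>X. I_past R p \<in> IP X R \<and> I_future R p \<in> IF X R)"

definition past_distinguishing :: "'a set \<Rightarrow> 'a rel \<Rightarrow> bool" where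
  "past_distinguishing X R \<longleftrightarrow> inj_on (I_past R) X"

definition past_reflecting :: "'a set \<Rightarrow> 'a rel \<Rightarrow> bool" where
  "past_reflecting X R \<longleftrightarrow>
     (\<forall>x\<in>X. \<forall>y\<in>X. I_past R x \<subseteq> I_past R y \<longrightarrow> I_future R y \<subseteq> I_future R x)"

definition chronological_space :: "'a topology \<Rightarrow> 'a rel \<Rightarrow> bool" where
  "chronological_space T R \<longleftrightarrow>
     chronological_set (topspace T) R \<and> past_distinguishing (topspace T) R \<and>
     preregular (topspace T) R \<and> past_reflecting (topspace T) R"

definition regular_chronological_space :: "'a topology \<Rightarrow> 'a rel \<Rightarrow> bool" where
  "regular_chronological_space T R \<longleftrightarrow>
     chronological_space T R \<and>
     (\<forall>p\<in>topspace T. openin T (I_past R p) \<and> openin T (I_future R p))"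

definition chronologically_dense :: "'a topology \<Rightarrow> 'a rel \<Rightarrow> bool" where
  "chronologically_dense T R \<longleftrightarrow>
     (\<forall>p\<in>topspace T.
        (I_past R p \<noteq> {} \<longrightarrow> p \<in> T closure_of (I_past R p)) \<and>
        (I_future R p \<noteq> {} \<longrightarrow> p \<in> T closure_of (I_future R p)))"

definition alpha_rel :: "'a set \<Rightarrow> 'a rel \<Rightarrow> 'a rel" where
  "alpha_rel X R = {(x, y) \<in> X \<times> X.
     I_future R y \<subseteq> I_future R x \<and> I_past R x \<subseteq> I_past R y}"

definition J_past :: "'a set \<Rightarrow> 'a rel \<Rightarrow> 'a \<Rightarrow> 'a set" where
  "J_past X R x = {y. (y, x) \<in> alpha_rel X R}"

definition J_future :: "'a set \<Rightarrow> 'a rel \<Rightarrow> 'a \<Rightarrow> 'a set" where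
  "J_future X R x = {y. (x, y) \<in> alpha_rel X R}"

definition J_past_of :: "'a set \<Rightarrow> 'a rel \<Rightarrow> 'a set \<Rightarrow> 'a set" where
  "J_past_of X R A = (\<Union>x\<in>A. J_past X R x)"

definition J_future_of :: "'a set \<Rightarrow> 'a rel \<Rightarrow> 'a set \<Rightarrow> 'a set" where
  "J_future_of X R A = (\<Union>x\<in>A. J_future X R x)"

definition alpha_causally_simple :: "'a topology \<Rightarrow> 'a rel \<Rightarrow> bool" where
  "alpha_causally_simple T R \<longleftrightarrow>
     (\<forall>p\<in>topspace T. closedin T (J_future (topspace T) R p) \<and>
                      closedin T (J_past (topspace T) R p))"

definition BS_rel :: "'a set \<Rightarrow> 'a rel \<Rightarrow> 'a set rel" where
  "BS_rel X R = {(A, B) \<in> IP X R \<times> IP X R. \<exists>x\<in>B. A \<subseteq> I_past R x}"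

definition IP_embed :: "'a rel \<Rightarrow> 'a \<Rightarrow> 'a set" where
  "IP_embed R x = I_past R x"

definition inner_continuous_at :: "'a topology \<Rightarrow> ('a \<Rightarrow> 'a set) \<Rightarrow> 'a \<Rightarrow> bool" where
  "inner_continuous_at T F p \<longleftrightarrow>
     (\<forall>C. compactin T C \<and> C \<subseteq> F p \<longrightarrow>
        (\<exists>U. openin T U \<and> p \<in> U \<and> (\<forall>q\<in>U. C \<subseteq> F q)))"

definition outer_continuous_at :: "'a topology \<Rightarrow> ('a \<Rightarrow> 'a set) \<Rightarrow> 'a \<Rightarrow> bool" where
  "outer_continuous_at T F p \<longleftrightarrow>
     (\<forall>C. compactin T C \<and> C \<subseteq> topspace T - T closure_of (F p) \<longrightarrow>
        (\<exists>U. openin T U \<and> p \<in> U \<and> (\<forall>q\<in>U. C \<subseteq> topspace T - T closure_of (F q))))"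

text \<open>The first conjunct says that \<open>I\<^sup>+\<close> and \<open>I\<^sup>-\<close> are maps into the open subsets.\<close>

definition causally_continuous :: "'a topology \<Rightarrow> 'a rel \<Rightarrow> bool" where
  "causally_continuous T R \<longleftrightarrow>
     (\<forall>p\<in>topspace T. openin T (I_future R p) \<and> openin T (I_past R p)) \<and>
     (\<forall>p\<in>topspace T.
        inner_continuous_at T (I_future R) p \<and> outer_continuous_at T (I_future R) p \<and>
        inner_continuous_at T (I_past R) p \<and> outer_continuous_at T (I_past R) p)"

end

theory Submission
  imports Defs
begin

text \<open>
  Past reflection makes \<open>x \<alpha> y\<close> equivalent to \<open>I\<^sup>-(x) \<subseteq> I\<^sup>-(y)\<close>, which settles the statements about
  \<open>i\<^sub>X\<close>. Everything else is symmetric under reversing time, and the key step is the inclusion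
  \<open>cl(I\<^sup>+(C)) \<subseteq> J\<^sup>+(C)\<close> for compact \<open>C\<close>: if \<open>y \<notin> J\<^sup>+(C)\<close>, then each \<open>x \<in> C\<close> lies outside the closed
  set \<open>J\<^sup>-(y)\<close>, so density moves \<open>x\<close> to some \<open>x' \<lless> x\<close> still outside it. Finitely many of the open
  sets \<open>I\<^sup>+(x')\<close> cover \<open>C\<close>, and the corresponding closed sets \<open>J\<^sup>+(x')\<close> contain \<open>I\<^sup>+(C)\<close> but not \<open>y\<close>.
\<close>

section \<open>Membership rules and reversal of time\<close>

lemma mem_I_past [simp]: "y \<in> I_past R x \<longleftrightarrow> (y, x) \<in> R"
  by (simp add: I_past_def)

lemma mem_I_future [simp]: "y \<in> I_future R x \<longleftrightarrow> (x, y) \<in> R"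
  by (simp add: I_future_def)

lemma mem_J_past: "y \<in> J_past X R x \<longleftrightarrow> (y, x) \<in> alpha_rel X R"
  by (simp add: J_past_def)

lemma mem_J_future: "y \<in> J_future X R x \<longleftrightarrow> (x, y) \<in> alpha_rel X R"
  by (simp add: J_future_def)

text \<open>The converse rules let the simplifier turn a result about futures, instantiated at
  \<open>R\<inverse>\<close>, into the result about pasts for \<open>R\<close>.\<close>

lemma I_past_converse [simp]: "I_past (R\<inverse>) = I_future R"
  by (auto simp: fun_eq_iff)

lemma I_future_converse [simp]: "I_future (R\<inverse>) = I_past R"
  by (auto simp: fun_eq_iff)

lemma I_future_of_converse [simp]: "I_future_of (R\<inverse>) = I_past_of R"
  by (simp add: fun_eq_iff I_future_of_def I_past_of_def)

lemma alpha_rel_converse: "(x, y) \<in> alpha_rel X (R\<inverse>) \<longleftrightarrow> (y, x) \<in> alpha_rel X R"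
  by (auto simp: alpha_rel_def)

lemma J_future_converse [simp]: "J_future X (R\<inverse>) = J_past X R"
  by (auto simp: fun_eq_iff mem_J_past mem_J_future alpha_rel_converse)

lemma J_past_converse [simp]: "J_past X (R\<inverse>) = J_future X R"
  by (auto simp: fun_eq_iff mem_J_past mem_J_future alpha_rel_converse)

lemma J_future_of_converse [simp]: "J_future_of X (R\<inverse>) = J_past_of X R"
  by (simp add: fun_eq_iff J_future_of_def J_past_of_def)

section \<open>The embedding into the indecomposable past sets\<close>

text \<open>Both halves come from \<open>I_past R x \<subseteq> I_past R y\<close>: a witness in the
  smaller past also lies in the larger one, and a point whose past contains the larger one has a
  past containing the smaller one.\<close>

lemma alpha_rel_IP_embed:
  assumes "preregular X R" "(x, y) \<in> alpha_rel X R"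
  shows "(IP_embed R x, IP_embed R y) \<in> alpha_rel (IP X R) (BS_rel X R)"
proof -
  have xy: "x \<in> X" "y \<in> X" "I_past R x \<subseteq> I_past R y"
    using assms(2) by (auto simp: alpha_rel_def)
  then have "I_past R x \<in> IP X R" "I_past R y \<in> IP X R"
    using assms(1) by (auto simp: preregular_def)
  moreover have "I_past (BS_rel X R) (I_past R x) \<subseteq> I_past (BS_rel X R) (I_past R y)"
  proof
    fix A assume "A \<in> I_past (BS_rel X R) (I_past R x)"
    then obtain z where "A \<in> IP X R" "z \<in> I_past R x" "A \<subseteq> I_past R z"
      unfolding mem_I_past[of A] BS_rel_def by blast
    moreover from this have "z \<in> I_past R y" using xy(3) by blast
    ultimately show "A \<in> I_past (BS_rel X R) (I_past R y)"
      using \<open>I_past R y \<in> IP X R\<close> unfolding mem_I_past[of A] BS_rel_def by blast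
  qed
  moreover have "I_future (BS_rel X R) (I_past R y) \<subseteq> I_future (BS_rel X R) (I_past R x)"
  proof
    fix B assume "B \<in> I_future (BS_rel X R) (I_past R y)"
    then obtain z where "B \<in> IP X R" "z \<in> B" "I_past R y \<subseteq> I_past R z"
      unfolding mem_I_future BS_rel_def by blast
    moreover from this have "I_past R x \<subseteq> I_past R z" using xy(3) by (rule_tac subset_trans)
    ultimately show "B \<in> I_future (BS_rel X R) (I_past R x)"
      using \<open>I_past R x \<in> IP X R\<close> unfolding mem_I_future BS_rel_def by blast
  qed
  ultimately show ?thesis
    unfolding alpha_rel_def IP_embed_def by blast
qed

text \<open>The embedding preserves the chronological relation, so each \<open>z\<close> in the past
  of \<open>x\<close> yields a pair of \<open>BS_rel\<close> that the assumption carries from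
  \<open>x\<close> to \<open>y\<close>. Past reflection brings this pair back to
  \<open>X\<close>.\<close>

lemma alpha_rel_if_IP_embed:
  assumes "R \<subseteq> X \<times> X" and pre: "preregular X R" and refl: "past_reflecting X R"
    and "x \<in> X" "y \<in> X"
    and emb: "(IP_embed R x, IP_embed R y) \<in> alpha_rel (IP X R) (BS_rel X R)"
  shows "(x, y) \<in> alpha_rel X R"
proof -
  have "(z, y) \<in> R" if "(z, x) \<in> R" for z
  proof -
    have "z \<in> X" using that assms(1) by blast
    \<comment> \<open>The witness is \<open>z\<close> itself.\<close>
    then have "(I_past R z, I_past R x) \<in> BS_rel X R"
      using that pre \<open>x \<in> X\<close> by (auto simp: preregular_def BS_rel_def)
    then have "(I_past R z, I_past R y) \<in> BS_rel X R"
      using emb by (auto simp: alpha_rel_def IP_embed_def)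
    then obtain w where w: "(w, y) \<in> R" "I_past R z \<subseteq> I_past R w"
      by (auto simp: BS_rel_def)
    \<comment> \<open>The witness \<open>w\<close> precedes \<open>y\<close>; by reflection so does
      \<open>z\<close>.\<close>
    then have "I_future R w \<subseteq> I_future R z"
      using refl assms(1) \<open>z \<in> X\<close> by (auto simp: past_reflecting_def)
    then show ?thesis using w(1) by auto
  qed
  then have "I_past R x \<subseteq> I_past R y" by auto
  then show ?thesis
    using refl assms(4,5) by (auto simp: past_reflecting_def alpha_rel_def)
qed

text \<open>The time-symmetric part of the hypotheses, so that every result can be dualised.\<close>

locale dense_simple_order =
  fixes T :: "'a topology" and R :: "'a rel"
  assumes rel_subset: "R \<subseteq> topspace T \<times> topspace T"
    and trans_rel: "trans R"
    and interpolation: "(x, y) \<in> R \<Longrightarrow> \<exists>s. (x, s) \<in> R \<and> (s, y) \<in> R"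
    and openin_past: "p \<in> topspace T \<Longrightarrow> openin T (I_past R p)"
    and openin_future: "p \<in> topspace T \<Longrightarrow> openin T (I_future R p)"
    and dense_past: "p \<in> topspace T \<Longrightarrow> p \<in> T closure_of (I_past R p)"
    and dense_future: "p \<in> topspace T \<Longrightarrow> p \<in> T closure_of (I_future R p)"
    and closedin_J_future: "p \<in> topspace T \<Longrightarrow> closedin T (J_future (topspace T) R p)"
    and closedin_J_past: "p \<in> topspace T \<Longrightarrow> closedin T (J_past (topspace T) R p)"
begin

text \<open>The assumptions either are self-dual or come in past and future pairs. Past reflection,
  whose dual is not assumed, stays outside the locale.\<close>

lemma dual: "dense_simple_order T (R\<inverse>)"
proof
  fix x y assume "(x, y) \<in> R\<inverse>"
  then show "\<exists>s. (x, s) \<in> R\<inverse> \<and> (s, y) \<in> R\<inverse>" using interpolation by blast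
qed (use rel_subset trans_rel openin_past openin_future dense_past dense_future
      closedin_J_future closedin_J_past in auto)

section \<open>Closures of chronological futures\<close>

lemma rel_subset_alpha: "R \<subseteq> alpha_rel (topspace T) R"
  using rel_subset trans_rel by (auto simp: alpha_rel_def dest: transD)

text \<open>By density \<open>y\<close> is a limit of its own future, which x \<alpha> y places
  inside the future of \<open>x\<close>.\<close>

lemma J_future_of_subset:
  assumes "C \<subseteq> topspace T"
  shows "J_future_of (topspace T) R C \<subseteq> T closure_of (I_future_of R C)"
proof
  fix y assume "y \<in> J_future_of (topspace T) R C"
  then obtain x where x: "x \<in> C" "(x, y) \<in> alpha_rel (topspace T) R"
    by (auto simp: J_future_of_def mem_J_future)
  then have "I_future R y \<subseteq> I_future_of R C" "y \<in> topspace T"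
    by (auto simp: alpha_rel_def I_future_of_def)
  then show "y \<in> T closure_of (I_future_of R C)"
    using dense_future closure_of_mono by blast
qed

lemma closure_I_future_of:
  assumes C: "compactin T C"
  shows "T closure_of (I_future_of R C) = J_future_of (topspace T) R C"
proof
  let ?X = "topspace T"
  have CX: "C \<subseteq> ?X" using C by (rule compactin_subset_topspace)
  show "J_future_of ?X R C \<subseteq> T closure_of (I_future_of R C)"
    using CX by (rule J_future_of_subset)
  show "T closure_of (I_future_of R C) \<subseteq> J_future_of ?X R C"
  proof (rule subsetI, rule ccontr)
    fix y assume y: "y \<in> T closure_of (I_future_of R C)" "y \<notin> J_future_of ?X R C"
    have yX: "y \<in> ?X" using y(1) by (meson in_closure_of)
    \<comment> \<open>The complement of the closed set \<open>J_past ?X R y\<close>, from which the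
      covering points are drawn.\<close>
    define Z where "Z = {z \<in> ?X. (z, y) \<notin> alpha_rel ?X R}"
    have "\<exists>z\<in>Z. (z, x) \<in> R" if "x \<in> C" for x
    proof -
      have "x \<in> ?X - J_past ?X R y"
        using that CX y(2) by (auto simp: J_future_of_def mem_J_past mem_J_future)
      moreover have "openin T (?X - J_past ?X R y)"
        using closedin_J_past[OF yX] by blast
      moreover have "x \<in> T closure_of (I_past R x)"
        using that CX by (intro dense_past) blast
      ultimately obtain z where "z \<in> I_past R x" "z \<in> ?X - J_past ?X R y"
        unfolding in_closure_of by meson
      then show ?thesis by (auto simp: Z_def mem_J_past)
    qed
    then have "C \<subseteq> \<Union> (I_future R ` Z)" by auto
    moreover have "\<forall>U\<in>I_future R ` Z. openin T U"
      using openin_future by (auto simp: Z_def)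
    ultimately obtain F where F: "finite F" "F \<subseteq> I_future R ` Z" "C \<subseteq> \<Union> F"
      using C unfolding compactin_def by meson
    then obtain N where N: "finite N" "N \<subseteq> Z" "F = I_future R ` N"
      by (meson finite_subset_image)
    have "I_future_of R C \<subseteq> (\<Union>z\<in>N. J_future ?X R z)"
    proof
      fix w assume "w \<in> I_future_of R C"
      then obtain x where "x \<in> C" "(x, w) \<in> R"
        by (auto simp: I_future_of_def)
      moreover from this obtain z where "z \<in> N" "(z, x) \<in> R"
        using F(3) N(3) by auto
      ultimately have "z \<in> N" "(z, w) \<in> R"
        using transD[OF trans_rel] by blast+
      then show "w \<in> (\<Union>z\<in>N. J_future ?X R z)"
        using rel_subset_alpha by (auto simp: mem_J_future)
    qed
    \<comment> \<open>Finiteness of \<open>N\<close>, gained from compactness, keeps the union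
      closed.\<close>
    moreover have "closedin T (\<Union>z\<in>N. J_future ?X R z)"
      using N closedin_J_future by (intro closedin_Union) (auto simp: Z_def)
    ultimately have "y \<in> (\<Union>z\<in>N. J_future ?X R z)"
      using y(1) closure_of_minimal by blast
    then show False using N(2) by (auto simp: Z_def mem_J_future)
  qed
qed

lemma closure_I_future:
  assumes "p \<in> topspace T"
  shows "T closure_of (I_future R p) = J_future (topspace T) R p"
  using closure_I_future_of[of "{p}"] assms by (simp add: I_future_of_def J_future_of_def)

section \<open>Causal continuity\<close>

text \<open>Interpolation covers \<open>C\<close> by futures of points \<open>s\<close> after
  \<open>p\<close>. For finitely many such \<open>s\<close>, the points preceding all of them form a
  neighbourhood of \<open>p\<close>, and transitivity through \<open>s\<close> reaches
  \<open>C\<close>.\<close>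

lemma inner_continuous_I_future:
  assumes p: "p \<in> topspace T"
  shows "inner_continuous_at T (I_future R) p"
  unfolding inner_continuous_at_def
proof (intro allI impI, elim conjE)
  fix C assume C: "compactin T C" "C \<subseteq> I_future R p"
  have "C \<subseteq> \<Union> (I_future R ` I_future R p)"
    using C(2) interpolation by fastforce
  moreover have "\<forall>U\<in>I_future R ` I_future R p. openin T U"
    using openin_future rel_subset by auto
  ultimately obtain F where F: "finite F" "F \<subseteq> I_future R ` I_future R p" "C \<subseteq> \<Union> F"
    using C(1) unfolding compactin_def by meson
  then obtain N where N: "finite N" "N \<subseteq> I_future R p" "F = I_future R ` N"
    by (meson finite_subset_image)
  \<comment> \<open>Intersecting with the whole space covers the case of empty \<open>N\<close>,
    where the inner intersection is \<open>UNIV\<close>.\<close>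
  let ?U = "topspace T \<inter> (\<Inter>s\<in>N. I_past R s)"
  have "I_future R p \<subseteq> topspace T" using rel_subset by auto
  with N(2) have "N \<subseteq> topspace T" by (rule subset_trans)
  then have "openin T ?U"
    using N(1) openin_past by (intro openin_Int_Inter) auto
  moreover have "p \<in> ?U" using p N(2) by auto
  moreover have "C \<subseteq> I_future R q" if "q \<in> ?U" for q
  proof
    fix c assume "c \<in> C"
    then obtain s where "s \<in> N" "(s, c) \<in> R" using F(3) N(3) by auto
    moreover from this have "(q, s) \<in> R" using that by auto
    ultimately show "c \<in> I_future R q" using transD[OF trans_rel] by auto
  qed
  ultimately show "\<exists>U. openin T U \<and> p \<in> U \<and> (\<forall>q\<in>U. C \<subseteq> I_future R q)" by blast
qed

text \<open>As the closure of \<open>I_future R q\<close> is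
  \<open>J_future (topspace T) R q\<close>, it misses \<open>C\<close> exactly when \<open>q\<close>
  lies outside the causal past of \<open>C\<close>. So the complement of that past is the required
  neighbourhood.\<close>

lemma outer_continuous_I_future:
  assumes p: "p \<in> topspace T"
  shows "outer_continuous_at T (I_future R) p"
  unfolding outer_continuous_at_def
proof (intro allI impI, elim conjE)
  interpret dual: dense_simple_order T "R\<inverse>" by (rule dual)
  let ?X = "topspace T"
  fix C assume C: "compactin T C" "C \<subseteq> ?X - T closure_of (I_future R p)"
  let ?U = "?X - J_past_of ?X R C"
  \<comment> \<open>The closure formula for the reversed relation shows that the causal past of a
    compact set is closed.\<close>
  have "J_past_of ?X R C = T closure_of (I_past_of R C)"
    using dual.closure_I_future_of[OF C(1)] by simp
  then have "openin T ?U" by (simp add: openin_diff)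
  moreover have "p \<in> ?U"
    using p C(2) by (auto simp: closure_I_future J_past_of_def mem_J_past mem_J_future)
  moreover have "C \<subseteq> ?X - T closure_of (I_future R q)" if "q \<in> ?U" for q
    using that C(2) by (auto simp: closure_I_future J_past_of_def mem_J_past mem_J_future)
  ultimately show "\<exists>U. openin T U \<and> p \<in> U \<and>
      (\<forall>q\<in>U. C \<subseteq> ?X - T closure_of (I_future R q))" by blast
qed

end

lemma regular_dense_simple_order:
  assumes "regular_chronological_space T R" "chronologically_dense T R"
    and "alpha_causally_simple T R"
  shows "dense_simple_order T R"
proof
  \<comment> \<open>Indecomposable sets are nonempty by definition, so preregularity discharges the
    condition in \<open>chronologically_dense\<close>.\<close>
  have "I_past R p \<noteq> {} \<and> I_future R p \<noteq> {}" if "p \<in> topspace T" for p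
    using assms(1) that
    by (auto simp: regular_chronological_space_def chronological_space_def preregular_def
        IP_def IF_def)
  then show "p \<in> T closure_of (I_past R p)" "p \<in> T closure_of (I_future R p)"
    if "p \<in> topspace T" for p
    using assms(2) that by (auto simp: chronologically_dense_def)
next
  have chr: "chronological_set (topspace T) R"
    using assms(1) by (simp add: regular_chronological_space_def chronological_space_def)
  then show "R \<subseteq> topspace T \<times> topspace T" "trans R"
    by (simp_all add: chronological_set_def)
  show "\<exists>s. (x, s) \<in> R \<and> (s, y) \<in> R" if "(x, y) \<in> R" for x y
    using chr that unfolding chronological_set_def by meson
qed (use assms in \<open>simp_all add: regular_chronological_space_def alpha_causally_simple_def\<close>)

theorem theorem22:
  fixes T :: "'a topology" and R :: "'a rel"
  assumes "regular_chronological_space T R"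
    and "chronologically_dense T R"
  shows "(\<forall>x\<in>topspace T. \<forall>y\<in>topspace T. (x, y) \<in> alpha_rel (topspace T) R \<longrightarrow>
            (IP_embed R x, IP_embed R y) \<in> alpha_rel (IP (topspace T) R) (BS_rel (topspace T) R)) \<and>
         (alpha_causally_simple T R \<longrightarrow>
            (\<forall>x\<in>topspace T. \<forall>y\<in>topspace T. (x, y) \<in> alpha_rel (topspace T) R \<longleftrightarrow>
               (IP_embed R x, IP_embed R y) \<in> alpha_rel (IP (topspace T) R) (BS_rel (topspace T) R)) \<and>
            (\<forall>C. compactin T C \<longrightarrow>
               J_future_of (topspace T) R C = T closure_of (I_future_of R C) \<and>
               J_past_of (topspace T) R C = T closure_of (I_past_of R C)) \<and>
            (\<forall>p\<in>topspace T. J_future (topspace T) R p = T closure_of (I_future R p) \<and>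
                     J_past (topspace T) R p = T closure_of (I_past R p)) \<and>
            causally_continuous T R)"
proof (intro conjI impI)
  let ?X = "topspace T"
  have R: "R \<subseteq> ?X \<times> ?X" "preregular ?X R" "past_reflecting ?X R"
    using assms(1) by (auto simp: regular_chronological_space_def chronological_space_def
        chronological_set_def)
  show "\<forall>x\<in>?X. \<forall>y\<in>?X. (x, y) \<in> alpha_rel ?X R \<longrightarrow>
      (IP_embed R x, IP_embed R y) \<in> alpha_rel (IP ?X R) (BS_rel ?X R)"
    using alpha_rel_IP_embed[OF R(2)] by blast
  assume simple: "alpha_causally_simple T R"
  interpret dense_simple_order T R
    using assms simple by (rule regular_dense_simple_order)
  \<comment> \<open>Supplies the past halves of the closure formulas and of causal
    continuity.\<close>
  interpret dual: dense_simple_order T "R\<inverse>" by (rule dual)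
  show "\<forall>x\<in>?X. \<forall>y\<in>?X. (x, y) \<in> alpha_rel ?X R \<longleftrightarrow>
      (IP_embed R x, IP_embed R y) \<in> alpha_rel (IP ?X R) (BS_rel ?X R)"
    using alpha_rel_IP_embed[OF R(2)] alpha_rel_if_IP_embed[OF R] by blast
  show "\<forall>C. compactin T C \<longrightarrow>
      J_future_of ?X R C = T closure_of (I_future_of R C) \<and>
      J_past_of ?X R C = T closure_of (I_past_of R C)"
    using closure_I_future_of dual.closure_I_future_of by simp
  show "\<forall>p\<in>?X. J_future ?X R p = T closure_of (I_future R p) \<and>
      J_past ?X R p = T closure_of (I_past R p)"
    using closure_I_future dual.closure_I_future by simp
  show "causally_continuous T R"
    using openin_past openin_future inner_continuous_I_future outer_continuous_I_future
      dual.inner_continuous_I_future dual.outer_continuous_I_future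
    by (simp add: causally_continuous_def)
qed

end
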